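(* Let $\mathbf{X}$ be a three-valued scheme. Then $\vDash^{ss}_{\mathbf{X}} \ =\ \vDash_2$ if and only if $\mathbf{X}$ is falsity-collapsible.
   Context: Language: $P$ is a denumerable (countably infinite) set of propositional variables, and $\mathcal{L}$ is the set of formulae generated from $P$ by the connectives $\neg$ (unary), $\wedge$, $\vee$ (binary). $\Gamma,\Delta$ range over arbitrary sets of formulae; a consequence relation is a set of pairs $(\Gamma,\Delta)$. Classical consequence $\vDash_2$: $\Gamma\vDash_2\Delta$ iff for every $v:\mathcal{L}\to\{0,1\}$ with $v(\neg A)=1-v(A)$, $v(A\wedge B)=\min(v(A),v(B))$, $v(A\vee B)=\max(v(A),v(B))$: if $v(A)=1$ for every $A\in\Gamma$, then $v(B)=1$ for some $B\in\Delta$. A three-valued scheme is a triple $\mathbf{X}=(f_\neg,f_\wedge,f_\vee)$ of operations on $\{1,\tfrac12,0\}$ (of arity $1,2,2$). An $\mathbf{X}$-valuation is a map $v:\mathcal{L}\to\{1,\tfrac12,0\}$ with $v(\neg A)=f_\neg(v(A))$, $v(A\wedge B)=f_\wedge(v(A),v(B))$, $v(A\vee B)=f_\vee(v(A),v(B))$. $\Gamma\vDash^{ss}_{\mathbf{X}}\Delta$ iff for every $\mathbf{X}$-valuation $v$: if $v(A)=1$ for every $A\in\Gamma$, then $v(B)=1$ for some $B\in\Delta$. Falsity-collapsibility: let $\tau_0:\{1,\tfrac12,0\}\to\{0,1\}$ be given by $\tau_0(0)=0$, $\tau_0(1)=1$, $\tau_0(\tfrac12)=0$. The scheme $\mathbf{X}$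 is falsity-collapsible ($0$-collapsible) iff for all $x,y\in\{1,\tfrac12,0\}$: $\tau_0(f_\neg(x))=1-\tau_0(x)$, $\tau_0(f_\wedge(x,y))=\min(\tau_0(x),\tau_0(y))$, and $\tau_0(f_\vee(x,y))=\max(\tau_0(x),\tau_0(y))$. *)

theory Defs
  imports Main "HOL-Library.Countable_Set"
begin

datatype 'p formula =
    Atom 'p
  | Neg "'p formula"
  | Conj "'p formula" "'p formula"
  | Disj "'p formula" "'p formula"

type_synonym 'p consequence = "('p formula set \<times> 'p formula set) set"

text \<open>Classical truth values are the integers 0 and 1; the range condition is explicit.\<close>

definition classical_valuation :: "('p formula \<Rightarrow> int) \<Rightarrow> bool" where
  "classical_valuation v \<longleftrightarrow>
     (\<forall>A. v A \<in> {0, 1}) \<and>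
     (\<forall>A. v (Neg A) = 1 - v A) \<and>
     (\<forall>A B. v (Conj A B) = min (v A) (v B)) \<and>
     (\<forall>A B. v (Disj A B) = max (v A) (v B))"

definition classical_consequence :: "'p consequence" where
  "classical_consequence =
     {(\<Gamma>, \<Delta>). \<forall>v. classical_valuation v \<longrightarrow>
        (\<forall>A\<in>\<Gamma>. v A = 1) \<longrightarrow> (\<exists>B\<in>\<Delta>. v B = 1)}"

datatype tv3 = One | Half | Zero

record scheme =
  f_neg :: "tv3 \<Rightarrow> tv3"
  f_conj :: "tv3 \<Rightarrow> tv3 \<Rightarrow> tv3"
  f_disj :: "tv3 \<Rightarrow> tv3 \<Rightarrow> tv3"

definition valuation :: "scheme \<Rightarrow> ('p formula \<Rightarrow> tv3) \<Rightarrow> bool" where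
  "valuation X v \<longleftrightarrow>
     (\<forall>A. v (Neg A) = f_neg X (v A)) \<and>
     (\<forall>A B. v (Conj A B) = f_conj X (v A) (v B)) \<and>
     (\<forall>A B. v (Disj A B) = f_disj X (v A) (v B))"

definition ss_consequence :: "scheme \<Rightarrow> 'p consequence" where
  "ss_consequence X =
     {(\<Gamma>, \<Delta>). \<forall>v. valuation X v \<longrightarrow>
        (\<forall>A\<in>\<Gamma>. v A = One) \<longrightarrow> (\<exists>B\<in>\<Delta>. v B = One)}"

fun \<tau>\<^sub>0 :: "tv3 \<Rightarrow> int" where
  "\<tau>\<^sub>0 Zero = 0"
| "\<tau>\<^sub>0 One = 1"
| "\<tau>\<^sub>0 Half = 0"

definition falsity_collapsible :: "scheme \<Rightarrow> bool" where
  "falsity_collapsible X \<longleftrightarrow>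
     (\<forall>x y. \<tau>\<^sub>0 (f_neg X x) = 1 - \<tau>\<^sub>0 x \<and>
            \<tau>\<^sub>0 (f_conj X x y) = min (\<tau>\<^sub>0 x) (\<tau>\<^sub>0 y) \<and>
            \<tau>\<^sub>0 (f_disj X x y) = max (\<tau>\<^sub>0 x) (\<tau>\<^sub>0 y))"

end

theory Submission
  imports Defs
begin

text \<open>
  Write \<open>\<tau>\<^sub>0 \<circ> v\<close> for the collapse of a three-valued valuation \<open>v\<close>. Since \<open>\<tau>\<^sub>0 x = 1\<close> holds only for
  \<open>x = One\<close>, a valuation and its collapse designate the same formulae, and everything turns on
  whether collapses are classical valuations.

  If the scheme is falsity-collapsible, they are, so a three-valued countermodel collapses to a
  classical one. In the other direction, a classical valuation \<open>u\<close> is the collapse of the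
  three-valued valuation that copies \<open>u\<close> on atoms: that collapse is classical, and classical
  valuations that agree on atoms agree everywhere. So the two consequence relations have the same
  countermodels.

  Conversely, suppose that classical consequence is included in three-valued consequence. A
  valuation \<open>v\<close> is a countermodel to the inference from all formulae of value \<open>One\<close> to all others.
  Hence that inference has a classical countermodel, and it can only be \<open>\<tau>\<^sub>0 \<circ> v\<close>
  (\<open>collapse_classical_if_sound\<close>): collapses are classical. As two distinct atoms can be given any
  two values independently, the classical clauses for collapses of formulae are then the equations
  of falsity-collapsibility for all values (\<open>collapsible_if_collapses_classical\<close>).
\<close>

lemma tau0_eq_1_iff: "\<tau>\<^sub>0 x = 1 \<longleftrightarrow> x = One"
  by (cases x) auto

lemma tau0_range: "\<tau>\<^sub>0 x \<in> {0, 1}"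
  by (cases x) auto

primrec extend :: "scheme \<Rightarrow> ('p \<Rightarrow> tv3) \<Rightarrow> 'p formula \<Rightarrow> tv3" where
  "extend X a (Atom p) = a p"
| "extend X a (Neg A) = f_neg X (extend X a A)"
| "extend X a (Conj A B) = f_conj X (extend X a A) (extend X a B)"
| "extend X a (Disj A B) = f_disj X (extend X a A) (extend X a B)"

lemma valuation_extend: "valuation X (extend X a)"
  by (simp add: valuation_def)

lemma classical_valuation_eqI:
  assumes "classical_valuation u" and "classical_valuation w"
    and "\<And>p. u (Atom p) = w (Atom p)"
  shows "u = w"
proof
  fix A
  show "u A = w A"
    using assms by (induction A) (simp_all add: classical_valuation_def)
qed

lemma collapse_classical_if_collapsible:
  assumes "falsity_collapsible X" and "valuation X v"
  shows "classical_valuation (\<tau>\<^sub>0 \<circ> v)"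
  using assms tau0_range
  by (simp add: classical_valuation_def falsity_collapsible_def valuation_def)

lemma classical_valuation_is_collapse:
  assumes X: "falsity_collapsible X" and u: "classical_valuation u"
  obtains v where "valuation X v" and "\<tau>\<^sub>0 \<circ> v = u"
proof
  define v where "v = extend X (\<lambda>p. if u (Atom p) = 1 then One else Zero)"
  show v: "valuation X v"
    by (simp add: v_def valuation_extend)
  have "u (Atom p) \<in> {0, 1}" for p
    using u by (simp add: classical_valuation_def)
  then have "(\<tau>\<^sub>0 \<circ> v) (Atom p) = u (Atom p)" for p
    by (auto simp: v_def)
  then show "\<tau>\<^sub>0 \<circ> v = u"
    by (rule classical_valuation_eqI[OF collapse_classical_if_collapsible[OF X v] u])
qed

text \<open>
  The inference from the designated formulae of \<open>v\<close> to the undesignated ones is refuted by a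
  two-valued \<open>u\<close> only if \<open>u\<close> is the characteristic function of designation in \<open>v\<close>. Soundness turns
  the refutation by \<open>v\<close> itself into a classical one.
\<close>

lemma collapse_classical_if_sound:
  fixes v :: "'p formula \<Rightarrow> tv3"
  assumes sound: "(classical_consequence :: 'p consequence) \<subseteq> ss_consequence X"
    and v: "valuation X v"
  shows "classical_valuation (\<tau>\<^sub>0 \<circ> v)"
proof -
  have "({A. v A = One}, {A. v A \<noteq> One}) \<notin> ss_consequence X"
    using v by (auto simp: ss_consequence_def)
  with sound have "({A. v A = One}, {A. v A \<noteq> One}) \<notin> classical_consequence"
    by blast
  then obtain u where u: "classical_valuation u"
    and pos: "\<And>A. v A = One \<Longrightarrow> u A = 1" and neg: "\<And>A. v A \<noteq> One \<Longrightarrow> u A \<noteq> 1"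
    by (auto simp: classical_consequence_def)
  have "\<tau>\<^sub>0 (v A) = u A" for A
  proof -
    have "u A \<in> {0, 1}"
      using u by (simp add: classical_valuation_def)
    then show ?thesis
      using pos[of A] neg[of A] by (cases "v A") auto
  qed
  then have "\<tau>\<^sub>0 \<circ> v = u"
    by auto
  with u show ?thesis
    by simp
qed

lemma collapsible_if_collapses_classical:
  fixes p q :: 'p
  assumes "p \<noteq> q"
    and classical: "\<And>v :: 'p formula \<Rightarrow> tv3. valuation X v \<Longrightarrow> classical_valuation (\<tau>\<^sub>0 \<circ> v)"
  shows "falsity_collapsible X"
  unfolding falsity_collapsible_def
proof (intro allI)
  fix x y
  define v where "v = extend X (\<lambda>r. if r = p then x else y)"
  have "classical_valuation (\<tau>\<^sub>0 \<circ> v)"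
    by (simp add: v_def classical valuation_extend)
  then have "\<tau>\<^sub>0 (v (Neg (Atom p))) = 1 - \<tau>\<^sub>0 (v (Atom p)) \<and>
      \<tau>\<^sub>0 (v (Conj (Atom p) (Atom q))) = min (\<tau>\<^sub>0 (v (Atom p))) (\<tau>\<^sub>0 (v (Atom q))) \<and>
      \<tau>\<^sub>0 (v (Disj (Atom p) (Atom q))) = max (\<tau>\<^sub>0 (v (Atom p))) (\<tau>\<^sub>0 (v (Atom q)))"
    by (simp add: classical_valuation_def)
  with \<open>p \<noteq> q\<close> show "\<tau>\<^sub>0 (f_neg X x) = 1 - \<tau>\<^sub>0 x \<and>
      \<tau>\<^sub>0 (f_conj X x y) = min (\<tau>\<^sub>0 x) (\<tau>\<^sub>0 y) \<and>
      \<tau>\<^sub>0 (f_disj X x y) = max (\<tau>\<^sub>0 x) (\<tau>\<^sub>0 y)"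
    by (simp add: v_def)
qed

lemma ss_consequence_eq_classical_if_collapsible:
  assumes X: "falsity_collapsible X"
  shows "(ss_consequence X :: 'p consequence) = classical_consequence"
proof -
  have "(\<forall>v. valuation X v \<longrightarrow> (\<forall>A\<in>\<Gamma>. v A = One) \<longrightarrow> (\<exists>B\<in>\<Delta>. v B = One)) \<longleftrightarrow>
      (\<forall>u. classical_valuation u \<longrightarrow> (\<forall>A\<in>\<Gamma>. u A = 1) \<longrightarrow> (\<exists>B\<in>\<Delta>. u B = 1))"
    (is "?ss \<longleftrightarrow> ?cl") for \<Gamma> \<Delta> :: "'p formula set"
  proof
    assume ss: ?ss
    show ?cl
    proof (intro allI impI)
      fix u :: "'p formula \<Rightarrow> int"
      assume u: "classical_valuation u" and \<Gamma>: "\<forall>A\<in>\<Gamma>. u A = 1"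
      obtain v where v: "valuation X v" and "\<tau>\<^sub>0 \<circ> v = u"
        using X u by (rule classical_valuation_is_collapse)
      then have u_eq_1_iff: "u A = 1 \<longleftrightarrow> v A = One" for A
        using tau0_eq_1_iff[of "v A"] by (metis comp_apply)
      have "\<forall>A\<in>\<Gamma>. v A = One"
        using \<Gamma> unfolding u_eq_1_iff .
      with ss v show "\<exists>B\<in>\<Delta>. u B = 1"
        unfolding u_eq_1_iff by blast
    qed
  next
    assume cl: ?cl
    show ?ss
    proof (intro allI impI)
      fix v
      assume v: "valuation X v" and "\<forall>A\<in>\<Gamma>. v A = One"
      with cl[rule_format, OF collapse_classical_if_collapsible[OF X v]]
      show "\<exists>B\<in>\<Delta>. v B = One"
        by (simp add: tau0_eq_1_iff)
    qed
  qed
  then show ?thesis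
    by (simp only: ss_consequence_def classical_consequence_def)
qed

theorem theorem3p3:
  fixes X :: scheme
  assumes "countable (UNIV :: 'p set)" and "infinite (UNIV :: 'p set)"
  shows "(ss_consequence X :: 'p consequence) = classical_consequence
           \<longleftrightarrow> falsity_collapsible X"
proof
  assume "(ss_consequence X :: 'p consequence) = classical_consequence"
  then have sound: "(classical_consequence :: 'p consequence) \<subseteq> ss_consequence X"
    by simp
  obtain p q :: 'p where "p \<noteq> q"
  proof -
    obtain q where "q \<notin> {undefined :: 'p}"
      using ex_new_if_finite[OF assms(2)] by blast
    then show thesis
      using that by blast
  qed
  then show "falsity_collapsible X"
    using collapse_classical_if_sound[OF sound] by (rule collapsible_if_collapses_classical)
next
  assume "falsity_collapsible X"
  then show "(ss_consequence X :: 'p consequence) = classical_consequence"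
    by (rule ss_consequence_eq_classical_if_collapsible)
qed

end
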